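(* For every integer $k\ge 1$ and every monotonically shrinking temporal complete $k$-partite graph $\mathcal{K}$ (that is, every monotonically shrinking temporal graph whose underlying static graph is complete $k$-partite), there exists a Nash equilibrium in the two-player temporal Voronoi game $\mathrm{Vor}(\mathcal{K},2)$.
   Context: A temporal graph $\mathcal{G}=(V,(E_t)_{t=1}^\infty)$ consists of a finite nonempty vertex set $V$ and an infinite sequence of edge sets $E_t\subseteq\binom{V}{2}$; it is assumed that the sequence is eventually constant (finite lifetime), i.e. there is $\tau$ with $E_t=E_\tau$ for all $t\ge\tau$. The underlying static graph is $(V,\bigcup_{t\ge1}E_t)$. A static graph is complete $k$-partite if its vertex set is partitioned into $k$ nonempty parts such that two vertices are adjacent if and only if they lie in different parts. $\mathcal{G}$ is monotonically shrinking if $E_{t+1}\subseteq E_t$ for all $t\ge 1$. A temporal walk from $u$ to $v$ is a sequence $(\{v_0=u,v_1\},t_1),(\{v_1,v_2\},t_2),\dots,(\{v_{d-1},v_d=v\},t_d)$ with $t_i<t_{i+1}$ for all $i\in\{1,\dots,d-1\}$ (strictly increasing times) and $\{v_{i-1},v_i\}\in E_{t_i}$ for all $i\in\{1,\dots,d\}$; its arrival time is $t_d$. The temporal distance $\mathrm{td}(u,v)$ is the minimum arrival time of a temporal walk from $u$ to $v$, with $\mathrm{td}(u,u)=0$ and $\mathrm{td}(u,v)=\infty$ if there is no such walk. In the two-player temporal Voronoi game $\mathrm{Vor}(\mathcal{G},2)$, each player $i\in\{1,2\}$ selects one vertex $p_i\in V$ (equal choices are allowed). Player $i$ wins the set $U_i(p_1,p_2)=\{v\in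 V\mid \mathrm{td}(p_i,v)<\mathrm{td}(p_j,v)\}$, where $j\ne i$ is the other player, and her payoff is $u_i(p_1,p_2)=|U_i(p_1,p_2)|$. A profile $(p_1,p_2)\in V^2$ is a Nash equilibrium if $u_1(p',p_2)\le u_1(p_1,p_2)$ and $u_2(p_1,p')\le u_2(p_1,p_2)$ for all $p'\in V$. *)

theory Defs
  imports "HOL-Library.Extended_Nat" "HOL-Library.Disjoint_Sets"
begin

text \<open>
  A temporal graph is a vertex set \<open>V\<close> with a sequence of edge sets \<open>E 1, E 2, \<dots>\<close>.
  Time starts at \<open>1\<close>: the value \<open>E 0\<close> is junk and no definition below depends on it.
\<close>

definition temporal_graph :: "'a set \<Rightarrow> (nat \<Rightarrow> 'a set set) \<Rightarrow> bool" where
  "temporal_graph V E \<longleftrightarrow>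
     finite V \<and> V \<noteq> {} \<and>
     (\<forall>t\<ge>1. E t \<subseteq> {e. e \<subseteq> V \<and> card e = 2}) \<and>
     (\<exists>\<tau>\<ge>1. \<forall>t\<ge>\<tau>. E t = E \<tau>)"

definition underlying_edges :: "(nat \<Rightarrow> 'a set set) \<Rightarrow> 'a set set" where
  "underlying_edges E = (\<Union>t\<in>{1..}. E t)"

definition monotonically_shrinking :: "(nat \<Rightarrow> 'a set set) \<Rightarrow> bool" where
  "monotonically_shrinking E \<longleftrightarrow> (\<forall>t\<ge>1. E (t + 1) \<subseteq> E t)"

text \<open>Nonemptiness of the parts is included in \<^const>\<open>partition_on\<close>.\<close>

definition complete_multipartite :: "nat \<Rightarrow> 'a set \<Rightarrow> 'a set set \<Rightarrow> bool" where
  "complete_multipartite k V F \<longleftrightarrow>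
     (\<exists>P. partition_on V P \<and> finite P \<and> card P = k \<and>
        (\<forall>u\<in>V. \<forall>v\<in>V. {u, v} \<in> F \<longleftrightarrow> \<not> (\<exists>A\<in>P. u \<in> A \<and> v \<in> A)))"

text \<open>
  A walk \<open>({v\<^sub>0,v\<^sub>1},t\<^sub>1), \<dots>, ({v\<^sub>d\<^sub>-\<^sub>1,v\<^sub>d},t\<^sub>d)\<close> is given by its vertex list
  \<open>vs = [v\<^sub>0, \<dots>, v\<^sub>d]\<close> and its time list \<open>ts = [t\<^sub>1, \<dots>, t\<^sub>d]\<close>, where \<open>d \<ge> 1\<close>.
\<close>

definition temporal_walk ::
    "(nat \<Rightarrow> 'a set set) \<Rightarrow> 'a \<Rightarrow> 'a \<Rightarrow> 'a list \<Rightarrow> nat list \<Rightarrow> bool" where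
  "temporal_walk E u v vs ts \<longleftrightarrow>
     ts \<noteq> [] \<and> length vs = length ts + 1 \<and> hd vs = u \<and> last vs = v \<and>
     sorted_wrt (<) ts \<and> (\<forall>t\<in>set ts. 1 \<le> t) \<and>
     (\<forall>i<length ts. {vs ! i, vs ! (i + 1)} \<in> E (ts ! i))"

text \<open>
  In \<^typ>\<open>enat\<close>, the infimum of a nonempty set is its minimum and that of the empty set is \<open>\<infinity>\<close>.
\<close>

definition temporal_dist :: "(nat \<Rightarrow> 'a set set) \<Rightarrow> 'a \<Rightarrow> 'a \<Rightarrow> enat" where
  "temporal_dist E u v =
     (if u = v then 0 else Inf {enat (last ts) | vs ts. temporal_walk E u v vs ts})"

text \<open>
  The first vertex argument of \<open>voronoi_cell\<close> and \<open>payoff\<close> is the choice of the player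
  concerned, the second that of her opponent; so player 1 receives \<open>payoff V E p1 p2\<close>
  and player 2 receives \<open>payoff V E p2 p1\<close>.
\<close>

definition voronoi_cell :: "'a set \<Rightarrow> (nat \<Rightarrow> 'a set set) \<Rightarrow> 'a \<Rightarrow> 'a \<Rightarrow> 'a set" where
  "voronoi_cell V E p q = {v \<in> V. temporal_dist E p v < temporal_dist E q v}"

definition payoff :: "'a set \<Rightarrow> (nat \<Rightarrow> 'a set set) \<Rightarrow> 'a \<Rightarrow> 'a \<Rightarrow> nat" where
  "payoff V E p q = card (voronoi_cell V E p q)"

definition nash_equilibrium :: "'a set \<Rightarrow> (nat \<Rightarrow> 'a set set) \<Rightarrow> 'a \<Rightarrow> 'a \<Rightarrow> bool" where
  "nash_equilibrium V E p1 p2 \<longleftrightarrow>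
     p1 \<in> V \<and> p2 \<in> V \<and>
     (\<forall>p'\<in>V. payoff V E p' p2 \<le> payoff V E p1 p2) \<and>
     (\<forall>p'\<in>V. payoff V E p' p1 \<le> payoff V E p2 p1)"

end

theory Submission
  imports Defs
begin

text \<open>
  Since the edge sets shrink, all edges of the underlying graph are already present at time 1.
  Hence a vertex reaches exactly the vertices of the other parts at time 1, and no vertex
  of its own part (other than itself) before time 2. Against an opponent at \<open>q\<close>, a player can
  therefore win at most her own vertex and the part of \<open>q\<close> without \<open>q\<close>, and she wins all of these
  by playing anywhere outside that part. So two vertices in different parts form an
  equilibrium. With a single part there are no edges, and a player wins at most her own vertex.
\<close>

lemma temporal_walk_arrival_ge_1:
  assumes "temporal_walk E u v vs ts"
  shows "1 \<le> last ts"
  using assms by (simp add: temporal_walk_def)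

text \<open>Times start at 1 and increase strictly, so a walk that arrives at time 1 has no room for
  a second step.\<close>

lemma temporal_walk_arrival_1:
  assumes "temporal_walk E u v vs ts" "last ts = 1"
  shows "{u, v} \<in> E 1"
proof -
  note w = assms(1)[unfolded temporal_walk_def]
  obtain xs where xs: "ts = xs @ [1]"
    using w assms(2) append_butlast_last_id by metis
  have "xs = []"
  proof (rule ccontr)
    assume "xs \<noteq> []"
    then obtain x where "x \<in> set xs" by (cases xs) auto
    then show False using w by (force simp: xs sorted_wrt_append)
  qed
  then have "length vs = 2" using w xs by simp
  then obtain a b where "vs = [a, b]"
    by (auto simp: numeral_2_eq_2 length_Suc_conv)
  then show ?thesis using w xs \<open>xs = []\<close> by auto
qed

lemma temporal_walk_in_underlying:
  assumes "temporal_walk E u v vs ts"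
  shows "underlying_edges E \<noteq> {}"
proof -
  have "0 < length ts" "\<forall>t\<in>set ts. 1 \<le> t" "\<forall>i<length ts. {vs ! i, vs ! (i + 1)} \<in> E (ts ! i)"
    using assms by (auto simp: temporal_walk_def)
  then show ?thesis unfolding underlying_edges_def
    by (metis (no_types, lifting) UN_I atLeast_iff empty_iff nth_mem)
qed

lemma temporal_dist_refl [simp]: "temporal_dist E u u = 0"
  by (simp add: temporal_dist_def)

lemma temporal_dist_ge_1:
  assumes "u \<noteq> v"
  shows "1 \<le> temporal_dist E u v"
proof -
  have "1 \<le> Inf {enat (last ts) | vs ts. temporal_walk E u v vs ts}"
    by (rule Inf_greatest)
      (auto simp: one_enat_def simp del: One_nat_def dest: temporal_walk_arrival_ge_1)
  then show ?thesis using assms by (simp add: temporal_dist_def)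
qed

lemma temporal_dist_adjacent:
  assumes "u \<noteq> v" "{u, v} \<in> E 1"
  shows "temporal_dist E u v = 1"
proof (rule antisym)
  have "temporal_walk E u v [u, v] [1]"
    using assms(2) by (simp add: temporal_walk_def)
  then have "enat (last [1]) \<in> {enat (last ts) | vs ts. temporal_walk E u v vs ts}"
    by blast
  then have "Inf {enat (last ts) | vs ts. temporal_walk E u v vs ts} \<le> enat (last [1])"
    by (rule Inf_lower)
  then show "temporal_dist E u v \<le> 1"
    using assms(1) by (simp add: temporal_dist_def one_enat_def)
qed (rule temporal_dist_ge_1[OF assms(1)])

lemma temporal_dist_nonadjacent:
  assumes "u \<noteq> v" "{u, v} \<notin> E 1"
  shows "1 < temporal_dist E u v"
proof -
  have "2 \<le> last ts" if "temporal_walk E u v vs ts" for vs ts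
    using temporal_walk_arrival_ge_1[OF that] temporal_walk_arrival_1[OF that] assms(2)
    by linarith
  then have "enat 2 \<le> Inf {enat (last ts) | vs ts. temporal_walk E u v vs ts}"
    by (intro Inf_greatest) auto
  moreover have "1 < enat 2" by (simp add: one_enat_def)
  ultimately show ?thesis using assms(1) by (simp add: temporal_dist_def less_le_trans)
qed

lemma temporal_dist_no_edges:
  assumes "u \<noteq> v" "underlying_edges E = {}"
  shows "temporal_dist E u v = \<infinity>"
proof -
  have "{enat (last ts) | vs ts. temporal_walk E u v vs ts} = {}"
    using assms(2) by (auto dest: temporal_walk_in_underlying)
  then show ?thesis using assms(1) by (simp add: temporal_dist_def top_enat_def)
qed

text \<open>This is where monotonicity enters: it turns the multipartite structure of the underlying
  graph into exact knowledge of \<open>E 1\<close>.\<close>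

lemma underlying_edges_shrinking:
  assumes "monotonically_shrinking E"
  shows "underlying_edges E = E 1"
proof -
  have "E t \<subseteq> E 1" if "1 \<le> t" for t
    using that
  proof (induction t rule: dec_induct)
    case (step n)
    then show ?case using assms by (fastforce simp: monotonically_shrinking_def)
  qed simp
  then show ?thesis unfolding underlying_edges_def by force
qed

lemma self_in_voronoi_cell:
  assumes "p \<in> V" "p \<noteq> q"
  shows "p \<in> voronoi_cell V E p q"
proof -
  have "(0::enat) < 1" by simp
  also have "1 \<le> temporal_dist E q p"
    using assms by (intro temporal_dist_ge_1) auto
  finally show ?thesis using assms by (simp add: voronoi_cell_def)
qed

text \<open>Here \<open>B\<close> stands for the part of \<open>q\<close>. Outside \<open>B\<close>
  the opponent arrives at time 1, and only a player's own vertex can be reached earlier than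
  that.\<close>

lemma voronoi_cell_upper:
  assumes adj: "\<And>v. v \<in> V - B \<Longrightarrow> {q, v} \<in> E 1"
  shows "voronoi_cell V E p q \<subseteq> insert p (B - {q})"
proof
  fix v
  assume "v \<in> voronoi_cell V E p q"
  then have v: "v \<in> V" "temporal_dist E p v < temporal_dist E q v"
    by (auto simp: voronoi_cell_def)
  then have "v \<noteq> q" by auto
  have False if "v \<noteq> p" "v \<notin> B"
    using temporal_dist_adjacent[of q v E] adj[of v] temporal_dist_ge_1[of p v E] v that \<open>v \<noteq> q\<close>
    by auto
  then show "v \<in> insert p (B - {q})" using \<open>v \<noteq> q\<close> by blast
qed

text \<open>From outside, \<open>p\<close> reaches all of \<open>B\<close> at time 1, whereas
  \<open>q\<close> needs time at least 2 for the other vertices of its own part.\<close>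

lemma voronoi_cell_lower:
  assumes "p \<in> V" "p \<notin> B" "q \<in> B" "B \<subseteq> V"
    and adj: "\<And>v. v \<in> B \<Longrightarrow> {p, v} \<in> E 1"
    and nonadj: "\<And>v. v \<in> B \<Longrightarrow> {q, v} \<notin> E 1"
  shows "insert p (B - {q}) \<subseteq> voronoi_cell V E p q"
proof -
  have "v \<in> voronoi_cell V E p q" if v: "v \<in> B - {q}" for v
  proof -
    have "temporal_dist E p v = 1"
      using v assms(2) adj by (intro temporal_dist_adjacent) auto
    moreover have "1 < temporal_dist E q v"
      using v nonadj by (intro temporal_dist_nonadjacent) auto
    ultimately show ?thesis using v assms(4) by (auto simp: voronoi_cell_def)
  qed
  moreover have "p \<in> voronoi_cell V E p q"
    using assms by (intro self_in_voronoi_cell) auto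
  ultimately show ?thesis by blast
qed

lemma payoff_optimal_outside_part:
  assumes "finite V" "B \<subseteq> V" "q \<in> B" "p \<in> V" "p \<notin> B"
    and "\<And>u v. u \<in> B \<Longrightarrow> v \<in> V \<Longrightarrow> {u, v} \<in> E 1 \<longleftrightarrow> v \<notin> B"
  shows "payoff V E p' q \<le> payoff V E p q"
proof -
  have fin: "finite B" using assms(1,2) finite_subset by blast
  have adj: "{p, v} \<in> E 1" if "v \<in> B" for v
    \<comment> \<open>The adjacency hypothesis starts from a vertex of \<open>B\<close>, so the edge
      is read from its end \<open>v\<close>.\<close>
    using assms(6)[OF that assms(4)] assms(5) by (simp add: insert_commute)
  have "payoff V E p' q \<le> card (insert p' (B - {q}))"
    unfolding payoff_def using assms fin by (intro card_mono voronoi_cell_upper) auto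
  \<comment> \<open>Only an inequality here, since the deviation \<open>p'\<close> may lie in
    \<open>B\<close>; for \<open>p\<close> outside \<open>B\<close> the count is exact.\<close>
  also have "\<dots> \<le> Suc (card (B - {q}))"
    by (rule card_insert_le_m1) auto
  also have "\<dots> = card (insert p (B - {q}))"
    using fin assms(5) by simp
  also have "\<dots> \<le> payoff V E p q"
    unfolding payoff_def
  proof (rule card_mono)
    show "finite (voronoi_cell V E p q)" using assms(1) by (simp add: voronoi_cell_def)
    show "insert p (B - {q}) \<subseteq> voronoi_cell V E p q"
      using assms adj by (intro voronoi_cell_lower) auto
  qed
  finally show ?thesis .
qed

text \<open>All distances between distinct vertices are infinite, and infinity is never strictly
  smaller than the opponent's distance.\<close>

lemma payoff_optimal_no_edges:
  assumes "finite V" "p \<in> V" "p \<noteq> q" "underlying_edges E = {}"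
  shows "payoff V E p' q \<le> payoff V E p q"
proof -
  have "v = p'" if "v \<in> voronoi_cell V E p' q" for v
    using that temporal_dist_no_edges[OF _ assms(4), of p' v]
    by (cases "v = p'") (auto simp: voronoi_cell_def)
  then have "voronoi_cell V E p' q \<subseteq> {p'}" by blast
  then have "payoff V E p' q \<le> card {p'}"
    unfolding payoff_def by (intro card_mono) auto
  also have "\<dots> = card {p}" by simp
  also have "\<dots> \<le> payoff V E p q"
    unfolding payoff_def using self_in_voronoi_cell[OF assms(2,3)] assms(1)
    by (intro card_mono) (auto simp: voronoi_cell_def)
  finally show ?thesis .
qed

theorem theorem12:
  fixes k :: nat and V :: "'a set" and E :: "nat \<Rightarrow> 'a set set"
  assumes "k \<ge> 1"
    and "temporal_graph V E"
    and "monotonically_shrinking E"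
    and "complete_multipartite k V (underlying_edges E)"
  shows "\<exists>p1 p2. nash_equilibrium V E p1 p2"
proof -
  have fin: "finite V" and "V \<noteq> {}"
    and edges: "\<And>t e. t \<ge> 1 \<Longrightarrow> e \<in> E t \<Longrightarrow> e \<subseteq> V \<and> card e = 2"
    using assms(2) by (auto simp: temporal_graph_def)
  obtain a where a: "a \<in> V" using \<open>V \<noteq> {}\<close> by blast
  obtain P where P: "partition_on V P"
    and adj: "\<And>u v. u \<in> V \<Longrightarrow> v \<in> V \<Longrightarrow> {u, v} \<in> E 1 \<longleftrightarrow> \<not> (\<exists>A\<in>P. u \<in> A \<and> v \<in> A)"
    using assms(4) by (auto simp: complete_multipartite_def underlying_edges_shrinking[OF assms(3)])
  have part_adj: "{u, v} \<in> E 1 \<longleftrightarrow> v \<notin> B" if "B \<in> P" "u \<in> B" "v \<in> V" for B u v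
  proof -
    have "u \<in> V" using P that by (auto simp: partition_on_def)
    \<comment> \<open>Parts are disjoint, so \<open>B\<close> is the only part that contains
      \<open>u\<close>.\<close>
    then show ?thesis using adj[OF _ that(3)] that P
      by (metis partition_onD2 disjointD disjoint_iff)
  qed
  obtain A where A: "A \<in> P" "a \<in> A" using P a by (auto simp: partition_on_def)
  have parts_subset: "B \<subseteq> V" if "B \<in> P" for B
    using P that by (auto simp: partition_on_def)
  \<comment> \<open>A single vertex is treated apart because it leaves no two distinct positions;
    the other cases are one part and at least two parts.\<close>
  consider "V = {a}" | "A = V" "V \<noteq> {a}" | b where "b \<in> V" "b \<notin> A"
    using parts_subset[OF A(1)] by blast
  then show ?thesis
  proof cases
    case 1
    then have "nash_equilibrium V E a a" by (simp add: nash_equilibrium_def)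
    then show ?thesis by blast
  next
    case 2
    then obtain b where b: "b \<in> V" "b \<noteq> a" using a by blast
    have "e \<notin> E 1" for e
    proof
      assume "e \<in> E 1"
      then obtain u v where "e = {u, v}" "u \<in> V" "v \<in> V"
        using edges[of 1 e] by (auto simp: card_2_iff)
      then show False using part_adj[OF A(1), of u v] \<open>e \<in> E 1\<close> 2 by auto
    qed
    then have "underlying_edges E = {}"
      using underlying_edges_shrinking[OF assms(3)] by blast
    then have "nash_equilibrium V E a b"
      using a b fin by (auto simp: nash_equilibrium_def intro!: payoff_optimal_no_edges)
    then show ?thesis by blast
  next
    case (3 b)
    then obtain B where B: "B \<in> P" "b \<in> B" using P by (auto simp: partition_on_def)
    \<comment> \<open>Since \<open>b\<close> lies outside \<open>A\<close>, the pair is an edge,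
      which it could not be inside \<open>B\<close>.\<close>
    have "a \<notin> B"
      using part_adj[OF A(1,2) 3(1)] part_adj[OF B a] 3(2) by (simp add: insert_commute)
    \<comment> \<open>Each player stands outside the opponent's part, so the optimality lemma is
      applied once with \<open>B\<close> and once with \<open>A\<close>.\<close>
    have "payoff V E p' b \<le> payoff V E a b" for p'
      using fin parts_subset[OF B(1)] B(2) a \<open>a \<notin> B\<close> part_adj[OF B(1)]
      by (rule payoff_optimal_outside_part)
    moreover have "payoff V E p' a \<le> payoff V E b a" for p'
      using fin parts_subset[OF A(1)] A(2) 3 part_adj[OF A(1)]
      by (rule payoff_optimal_outside_part)
    ultimately have "nash_equilibrium V E a b"
      using a 3(1) by (simp add: nash_equilibrium_def)
    then show ?thesis by blast
  qed
qed

end
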